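(* Let $u_0\in\mathscr{A}$ and let $(u_j)_{j\ge0}$ be the sequence in $\mathscr{A}$ defined recursively by $u_j=\frac1j\sum_{\ell=0}^{j-1}\mathscr{P}(u_\ell,u_{j-\ell-1})$ for $j=1,2,3,\dots$. Then for every $j\in\{0,1,2,\dots\}$: $$\mathscr{E}_*(S,a)u_j=u_j\quad\text{for all }(S,a)\in\mathcal{H}(u_0);$$ $$-\mathscr{E}_*(S,a)u_j=(-1)^ju_j\quad\text{for all }(S,a)\in\mathcal{H}^-(u_0).$$
   Context: $\mathbb{T}^3:=(\mathbb{R}/2\pi\mathbb{Z})^3$. $\mathscr{A}$ is the space of real-analytic, zero mean, divergence free vector fields $v:\mathbb{T}^3\to\mathbb{R}^3$, with Fourier coefficients $v_k\in\mathbb{C}^3$, $v(x)=\sum_{k\in\mathbb{Z}^3}v_ke^{ik\cdot x}$; $a\cdot b=\sum_sa_sb_s$. $\mathscr{P}(v,w):=-\mathfrak{L}(v\cdot\nabla w)$ with $\mathfrak{L}$ the Leray projection onto divergence free fields; in Fourier terms $\mathscr{P}(v,w)_k=-i\sum_{h\in\mathbb{Z}^3}(v_h\cdot(k-h))\,\mathfrak{L}_kw_{k-h}$, where $\mathfrak{L}_kc=c-(k\cdot c)k/|k|^2$ for $k\ne0$, $\mathfrak{L}_0c=c$; it maps $\mathscr{A}\times\mathscr{A}$ to $\mathscr{A}$. $O_h$ is the group of orthogonal $3\times3$ matrices with integer entries. $O_h\ltimes\mathbb{T}^3$ is the set $O_h\times\mathbb{T}^3$ with product $(S,a)(U,b)=(SU,a+Sb)$.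 For $(S,a)$ in it, $(\mathscr{E}_*(S,a)v)(x):=S\,v(S^{T}(x-a))$ ($S^T$ the transpose). The symmetry subgroup of $u_0$ is $\mathcal{H}(u_0):=\{(S,a)\in O_h\ltimes\mathbb{T}^3:\mathscr{E}_*(S,a)u_0=u_0\}$; the pseudo-symmetry space is $\mathcal{H}^-(u_0):=\{(S,a)\in O_h\ltimes\mathbb{T}^3:-\mathscr{E}_*(S,a)u_0=u_0\}$ (possibly empty). *)

theory Defs
  imports "HOL-Analysis.Analysis" "HOL-Algebra.Group"
begin

section \<open>The torus and its characters\<close>

definition real_vec :: "int ^ 'n \<Rightarrow> real ^ 'n" where
  "real_vec k = (\<chi> s. real_of_int (k $ s))"

definition complex_vec :: "int ^ 'n \<Rightarrow> complex ^ 'n" where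
  "complex_vec k = (\<chi> s. complex_of_int (k $ s))"

definition real_mat :: "int ^ 'n ^ 'm \<Rightarrow> real ^ 'n ^ 'm" where
  "real_mat S = (\<chi> r s. real_of_int (S $ r $ s))"

lemma real_vec_add: "real_vec (k + l) = real_vec k + real_vec l"
  by (simp add: real_vec_def vec_eq_iff)

lemma real_vec_minus: "real_vec (- k) = - real_vec k"
  by (simp add: real_vec_def vec_eq_iff)

lemma real_vec_zero: "real_vec 0 = 0"
  by (simp add: real_vec_def vec_eq_iff)

lemma real_mat_vec: "real_mat S *v real_vec k = real_vec (S *v k)"
  by (simp add: real_mat_def real_vec_def vec_eq_iff matrix_vector_mult_def)

definition torus_rel :: "real ^ 3 \<Rightarrow> real ^ 3 \<Rightarrow> bool" where
  "torus_rel x y \<longleftrightarrow> (\<exists>k :: int ^ 3. x = y + (2 * pi) *\<^sub>R real_vec k)"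

lemma equivp_torus_rel: "equivp torus_rel"
proof (rule equivpI)
  show "reflp torus_rel"
    by (auto simp: reflp_def torus_rel_def intro!: exI[of _ 0] simp: real_vec_zero)
  show "symp torus_rel"
  proof (rule sympI)
    fix x y assume "torus_rel x y"
    then obtain k where "x = y + (2 * pi) *\<^sub>R real_vec k"
      by (auto simp: torus_rel_def)
    then show "torus_rel y x"
      by (auto simp: torus_rel_def real_vec_minus intro!: exI[of _ "- k"])
  qed
  show "transp torus_rel"
  proof (rule transpI)
    fix x y z assume "torus_rel x y" "torus_rel y z"
    then obtain k l where "x = y + (2 * pi) *\<^sub>R real_vec k" "y = z + (2 * pi) *\<^sub>R real_vec l"
      by (auto simp: torus_rel_def)
    then show "torus_rel x z"
      by (auto simp: torus_rel_def real_vec_add scaleR_right_distrib intro!: exI[of _ "l + k"])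
  qed
qed

quotient_type torus = "real ^ 3" / torus_rel
  morphisms rep_torus torus_of
  by (rule equivp_torus_rel)

instantiation torus :: ab_group_add
begin

lift_definition zero_torus :: torus is "0 :: real ^ 3" .

lift_definition plus_torus :: "torus \<Rightarrow> torus \<Rightarrow> torus" is "\<lambda>x y. x + y"
proof -
  fix x x' y y' :: "real ^ 3"
  assume "torus_rel x x'" "torus_rel y y'"
  then obtain k l where "x = x' + (2 * pi) *\<^sub>R real_vec k" "y = y' + (2 * pi) *\<^sub>R real_vec l"
    by (auto simp: torus_rel_def)
  then show "torus_rel (x + y) (x' + y')"
    by (auto simp: torus_rel_def real_vec_add scaleR_right_distrib intro!: exI[of _ "k + l"])
qed

lift_definition uminus_torus :: "torus \<Rightarrow> torus" is "\<lambda>x. - x"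
proof -
  fix x x' :: "real ^ 3"
  assume "torus_rel x x'"
  then obtain k where "x = x' + (2 * pi) *\<^sub>R real_vec k"
    by (auto simp: torus_rel_def)
  then show "torus_rel (- x) (- x')"
    by (auto simp: torus_rel_def real_vec_minus intro!: exI[of _ "- k"])
qed

definition minus_torus :: "torus \<Rightarrow> torus \<Rightarrow> torus" where
  "minus_torus x y = x + (- y)"

instance
proof
  fix a b c :: torus
  have refl: "torus_rel x x" for x
    using equivp_torus_rel by (rule equivp_reflp)
  show "a + b + c = a + (b + c)"
    by transfer (simp add: add.assoc refl)
  show "a + b = b + a"
    by transfer (simp add: add.commute refl)
  show "0 + a = a"
    by transfer (simp add: refl)
  show "- a + a = 0"
    by transfer (simp add: refl)
  show "a - b = a + - b"
    by (rule minus_torus_def)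
qed

end

text \<open>The action of an integer matrix on the torus, and the character $x \mapsto e^{i k \cdot x}$.\<close>

lift_definition torus_act :: "int ^ 3 ^ 3 \<Rightarrow> torus \<Rightarrow> torus" is "\<lambda>S x. real_mat S *v x"
proof -
  fix S :: "int ^ 3 ^ 3" and x y :: "real ^ 3"
  assume "torus_rel x y"
  then obtain k where "x = y + (2 * pi) *\<^sub>R real_vec k"
    by (auto simp: torus_rel_def)
  then show "torus_rel (real_mat S *v x) (real_mat S *v y)"
    by (auto simp: torus_rel_def matrix_vector_right_distrib matrix_vector_mult_scaleR
        real_mat_vec intro!: exI[of _ "S *v k"])
qed

lift_definition character :: "int ^ 3 \<Rightarrow> torus \<Rightarrow> complex" is "\<lambda>k x. cis (real_vec k \<bullet> x)"
proof -
  fix k :: "int ^ 3" and x y :: "real ^ 3"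
  assume "torus_rel x y"
  then obtain l where l: "x = y + (2 * pi) *\<^sub>R real_vec l"
    by (auto simp: torus_rel_def)
  have "real_vec k \<bullet> real_vec l = real_of_int (\<Sum>s\<in>UNIV. k $ s * l $ s)"
    by (simp add: inner_vec_def real_vec_def)
  then have "cis (real_vec k \<bullet> x)
      = cis (real_vec k \<bullet> y) * cis (2 * pi * real_of_int (\<Sum>s\<in>UNIV. k $ s * l $ s))"
    by (simp only: l inner_add_right inner_scaleR_right cis_mult)
  also have "cis (2 * pi * real_of_int (\<Sum>s\<in>UNIV. k $ s * l $ s)) = 1"
    by (rule cis_multiple_2pi) (rule Ints_of_int)
  finally show "cis (real_vec k \<bullet> x) = cis (real_vec k \<bullet> y)"
    by simp
qed

section \<open>Vector fields\<close>

type_synonym vfield = "torus \<Rightarrow> real ^ 3"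

text \<open>Near a point \<open>x\<close> of the torus, \<open>y \<mapsto> x + torus_of y\<close> is a chart centred at \<open>x\<close>.
  Real-analyticity is the existence, at each point, of a convergent power series over multi-indices
  \<open>\<alpha> :: nat ^ 3\<close>.\<close>

definition real_analytic_field :: "vfield \<Rightarrow> bool" where
  "real_analytic_field v \<longleftrightarrow>
     (\<forall>x. \<exists>r > 0. \<exists>c :: nat ^ 3 \<Rightarrow> real ^ 3. \<forall>y. norm y < r \<longrightarrow>
        ((\<lambda>\<alpha>. (\<Prod>s\<in>UNIV. (y $ s) ^ (\<alpha> $ s)) *\<^sub>R c \<alpha>) has_sum v (x + torus_of y)) UNIV)"

text \<open>The value 0 at points of non-differentiability is a totalization convention only; it is never
  used for real-analytic fields.\<close>

definition partial :: "3 \<Rightarrow> vfield \<Rightarrow> vfield" where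
  "partial s v x =
     (if (\<lambda>y. v (x + torus_of y)) differentiable (at 0)
      then frechet_derivative (\<lambda>y. v (x + torus_of y)) (at 0) (axis s 1) else 0)"

definition divergence :: "vfield \<Rightarrow> torus \<Rightarrow> real" where
  "divergence v x = (\<Sum>s\<in>UNIV. partial s v x $ s)"

definition torus_box :: "(real ^ 3) set" where
  "torus_box = cbox 0 (\<chi> s. 2 * pi)"

definition zero_mean :: "vfield \<Rightarrow> bool" where
  "zero_mean v \<longleftrightarrow> integral torus_box (\<lambda>y. v (torus_of y)) = 0"

definition analytic_fields :: "vfield set" where
  "analytic_fields =
     {v. real_analytic_field v \<and> zero_mean v \<and> (\<forall>x. divergence v x = 0)}"

section \<open>Leray projection and the bilinear map\<close>

definition fourier_coeff :: "vfield \<Rightarrow> int ^ 3 \<Rightarrow> complex ^ 3" where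
  "fourier_coeff v k = (\<chi> s. complex_of_real (1 / (2 * pi) ^ 3) *
     integral torus_box
       (\<lambda>y. complex_of_real (v (torus_of y) $ s) * character (- k) (torus_of y)))"

text \<open>The bilinear (not Hermitian) product.\<close>

definition cdot :: "complex ^ 3 \<Rightarrow> complex ^ 3 \<Rightarrow> complex" where
  "cdot a b = (\<Sum>s\<in>UNIV. a $ s * b $ s)"

definition leray_symbol :: "int ^ 3 \<Rightarrow> complex ^ 3 \<Rightarrow> complex ^ 3" where
  "leray_symbol k c =
     (if k = 0 then c
      else c - (cdot (complex_vec k) c / complex_of_real ((norm (real_vec k))\<^sup>2)) *s complex_vec k)"

text \<open>The Fourier series below is real for every (real) field \<open>v\<close> since the coefficients at \<open>k\<close> and
  \<open>- k\<close> are conjugate; \<open>Re\<close> only changes the type.\<close>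

definition leray :: "vfield \<Rightarrow> vfield" where
  "leray v x =
     (\<chi> s. Re ((\<Sum>\<^sub>\<infinity>k. character k x *s leray_symbol k (fourier_coeff v k)) $ s))"

definition advect :: "vfield \<Rightarrow> vfield \<Rightarrow> vfield" where
  "advect v w x = (\<Sum>s\<in>UNIV. (v x $ s) *\<^sub>R partial s w x)"

definition bilin :: "vfield \<Rightarrow> vfield \<Rightarrow> vfield" where
  "bilin v w x = - leray (advect v w) x"

section \<open>Symmetries\<close>

definition Oh :: "(int ^ 3 ^ 3) set" where
  "Oh = {S. orthogonal_matrix S}"

definition Oh_torus :: "((int ^ 3 ^ 3) \<times> torus) monoid" where
  "Oh_torus = \<lparr>carrier = Oh \<times> UNIV,
     monoid.mult = (\<lambda>(S, a) (U, b). (S ** U, a + torus_act S b)),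
     one = (mat 1, 0)\<rparr>"

definition push :: "(int ^ 3 ^ 3) \<times> torus \<Rightarrow> vfield \<Rightarrow> vfield" where
  "push = (\<lambda>(S, a) v x. real_mat S *v v (torus_act (transpose S) (x - a)))"

definition symmetry_subgroup :: "vfield \<Rightarrow> ((int ^ 3 ^ 3) \<times> torus) set" where
  "symmetry_subgroup v = {g \<in> carrier Oh_torus. push g v = v}"

definition pseudo_symmetry_space :: "vfield \<Rightarrow> ((int ^ 3 ^ 3) \<times> torus) set" where
  "pseudo_symmetry_space v = {g \<in> carrier Oh_torus. (\<lambda>x. - push g v x) = v}"

end

theory Submission
  imports Defs
begin

text \<open>The bilinear map is equivariant under the whole group:
  P(E v, E w) = E P(v, w) for E = push (S, a), and P(c v, d w) = c d P(v, w). Hence if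
  E u_0 = e u_0 with e = 1 or e = -1, then E multiplies P(u_l, u_(j-l-1)) by
  e^(l+1) e^(j-l) = e^(j+1), and strong induction on j gives E u_j = e^(j+1) u_j.

  The equivariance holds for arbitrary fields, because an element of Oh is a signed permutation
  matrix: it maps boxes to boxes and coordinates to coordinates up to sign, and it is invertible.
  Thus differentiability, integrability of each component and summability of the Fourier series
  hold for v if and only if they hold for E v, and the conventional value 0 in the degenerate cases
  is respected.\<close>

section \<open>Signed permutation matrices acting on the torus\<close>

(* This simp rule would rewrite transpose S *v k to k v* S. *)
declare transpose_matrix_vector [simp del]

text \<open>A nonzero integer has square at least 1, so a sum of squares equal to 1 leaves room for
  a single nonzero entry.\<close>

lemma sum_squares_int_eq_1:
  fixes f :: "'a :: finite \<Rightarrow> int"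
  assumes "(\<Sum>i\<in>UNIV. f i * f i) = 1"
  obtains i where "f i = 1 \<or> f i = -1" and "\<And>j. j \<noteq> i \<Longrightarrow> f j = 0"
proof -
  obtain i where i: "f i \<noteq> 0"
    using assms by fastforce
  have split: "f i * f i + (\<Sum>j\<in>-{i}. f j * f j) = 1"
    using assms by (simp add: sum.remove[of UNIV i] Compl_eq_Diff_UNIV)
  have "f i * f i > 0"
    using i by (simp add: zero_less_mult_iff) linarith
  moreover have nonneg: "(\<Sum>j\<in>-{i}. f j * f j) \<ge> 0"
    by (intro sum_nonneg) simp
  ultimately have "f i * f i = 1" "(\<Sum>j\<in>-{i}. f j * f j) = 0"
    using split by linarith+
  then have "f i = 1 \<or> f i = -1" "\<And>j. j \<noteq> i \<Longrightarrow> f j = 0"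
    by (auto simp: zmult_eq_1_iff sum_nonneg_eq_0_iff)
  then show thesis
    by (rule that)
qed

text \<open>Rows of an orthogonal matrix have unit length, which yields one entry 1 or -1 per row
  and defines \<open>\<sigma>\<close>. Columns have unit length too, so \<open>\<sigma>\<close> is
  injective, hence bijective on a finite type.\<close>

lemma Oh_signed_permutation:
  assumes "S \<in> Oh"
  obtains \<sigma> \<epsilon> where "bij \<sigma>" and "\<And>s. \<epsilon> s = 1 \<or> \<epsilon> s = -1"
    and "\<And>s t. S $ s $ t = (if t = \<sigma> s then \<epsilon> s else 0)"
proof -
  have rows: "(\<Sum>t\<in>UNIV. S $ s $ t * S $ s $ t) = 1"
    and cols: "(\<Sum>t\<in>UNIV. S $ t $ s * S $ t $ s) = 1" for s
    using assms
    by (auto simp: Oh_def orthogonal_matrix_def vec_eq_iff matrix_matrix_mult_def transpose_def mat_def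
        dest!: spec[of _ s])
  have "\<exists>t. (S $ s $ t = 1 \<or> S $ s $ t = -1) \<and> (\<forall>t'. t' \<noteq> t \<longrightarrow> S $ s $ t' = 0)" for s
    using sum_squares_int_eq_1[OF rows[of s]] by metis
  then obtain \<sigma> where \<sigma>: "\<And>s. S $ s $ \<sigma> s = 1 \<or> S $ s $ \<sigma> s = -1"
      "\<And>s t. t \<noteq> \<sigma> s \<Longrightarrow> S $ s $ t = 0"
    by metis
  have "inj \<sigma>"
  proof (rule injI)
    fix s s' assume eq: "\<sigma> s = \<sigma> s'"
    obtain r where r: "\<And>q. q \<noteq> r \<Longrightarrow> S $ q $ \<sigma> s = 0"
      using sum_squares_int_eq_1[OF cols[of "\<sigma> s"]] by metis
    have "S $ s $ \<sigma> s \<noteq> 0" "S $ s' $ \<sigma> s \<noteq> 0"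
      using \<sigma>(1)[of s] \<sigma>(1)[of s'] eq by auto
    then show "s = s'"
      using r by metis
  qed
  then have "bij \<sigma>"
    by (simp add: bij_def finite_UNIV_inj_surj)
  then show thesis
    using \<sigma> by (intro that[of \<sigma> "\<lambda>s. S $ s $ \<sigma> s"]) auto
qed

lemma matrix_vector_mult_minus_right: "A *v (- x) = - (A *v (x :: 'a :: ring_1 ^ 'n))"
  using matrix_vector_mult_diff_distrib[of A 0 x] by simp

definition complex_mat :: "int ^ 'n ^ 'm \<Rightarrow> complex ^ 'n ^ 'm" where
  "complex_mat S = (\<chi> r s. complex_of_int (S $ r $ s))"

text \<open>One choice of \<open>\<sigma>\<close> and of real signs \<open>\<epsilon>\<close> serves
  the real and the complex action at once. Arguments can then go component by component, where a
  real sign passes through integrals and real parts.\<close>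

lemma Oh_coordinates:
  assumes "S \<in> Oh"
  obtains \<sigma> \<epsilon> where "bij \<sigma>" and "\<And>s. \<epsilon> s = 1 \<or> \<epsilon> s = (-1 :: real)"
    and "\<And>x s. (real_mat S *v x) $ s = \<epsilon> s * x $ \<sigma> s"
    and "\<And>x s. (complex_mat S *v x) $ s = complex_of_real (\<epsilon> s) * x $ \<sigma> s"
proof -
  obtain \<sigma> \<epsilon> where \<sigma>: "bij \<sigma>" "\<And>s. \<epsilon> s = 1 \<or> \<epsilon> s = -1"
      "\<And>s t. S $ s $ t = (if t = \<sigma> s then \<epsilon> s else 0)"
    by (rule Oh_signed_permutation[OF assms]) (rule that; assumption)
  have "(real_mat S *v x) $ s = real_of_int (\<epsilon> s) * x $ \<sigma> s"
    "(complex_mat S *v y) $ s = complex_of_real (real_of_int (\<epsilon> s)) * y $ \<sigma> s" for x y s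
    by (simp_all add: matrix_vector_mult_def real_mat_def complex_mat_def \<sigma>(3)
        if_distrib if_distribR cong: if_cong)
  moreover have "real_of_int (\<epsilon> s) = 1 \<or> real_of_int (\<epsilon> s) = -1" for s
    using \<sigma>(2)[of s] by auto
  ultimately show thesis
    using \<sigma>(1) by (intro that[of \<sigma> "\<lambda>s. real_of_int (\<epsilon> s)"])
qed

section \<open>Matrix identities: transposition inverts the elements of \<open>Oh\<close>\<close>

lemma real_mat_mult: "real_mat (A ** B) = real_mat A ** real_mat B"
  by (simp add: real_mat_def matrix_matrix_mult_def vec_eq_iff)

lemma complex_mat_mult: "complex_mat (A ** B) = complex_mat A ** complex_mat B"
  by (simp add: complex_mat_def matrix_matrix_mult_def vec_eq_iff)

lemma real_mat_transpose: "real_mat (transpose A) = transpose (real_mat A)"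
  by (simp add: real_mat_def transpose_def)

lemma real_mat_1: "real_mat (mat 1) = mat 1"
  by (simp add: real_mat_def mat_def vec_eq_iff)

lemma complex_mat_1: "complex_mat (mat 1) = mat 1"
  by (simp add: complex_mat_def mat_def vec_eq_iff)

lemma Oh_mult_transpose:
  assumes "S \<in> Oh"
  shows "transpose S ** S = mat 1" "S ** transpose S = mat 1"
  using assms by (auto simp: Oh_def orthogonal_matrix_def)

lemma Oh_transpose: "S \<in> Oh \<Longrightarrow> transpose S \<in> Oh"
  by (auto simp: Oh_def orthogonal_matrix_def)

lemma Oh_real_mat_cancel:
  assumes "S \<in> Oh"
  shows "real_mat (transpose S) *v (real_mat S *v x) = x"
    "real_mat S *v (real_mat (transpose S) *v x) = x"
  using assms
  by (simp_all add: matrix_vector_mul_assoc flip: real_mat_mult)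
    (simp_all add: Oh_mult_transpose real_mat_1)

lemma Oh_complex_mat_cancel:
  assumes "S \<in> Oh"
  shows "complex_mat (transpose S) *v (complex_mat S *v x) = x"
  using assms
  by (simp add: matrix_vector_mul_assoc flip: complex_mat_mult)
    (simp add: Oh_mult_transpose complex_mat_1)

lemma Oh_int_cancel:
  assumes "S \<in> Oh"
  shows "transpose S *v (S *v (k :: int ^ 3)) = k" "S *v (transpose S *v k) = k"
  using assms by (simp_all add: matrix_vector_mul_assoc Oh_mult_transpose)

lemma Oh_bij:
  assumes "S \<in> Oh"
  shows "bij ((*v) S :: int ^ 3 \<Rightarrow> int ^ 3)"
  using assms by (intro bij_betw_byWitness[where f' = "(*v) (transpose S)"]) (auto simp: Oh_int_cancel)

section \<open>The torus, its matrix action and its characters, computed on representatives\<close>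

lemma torus_act_torus_of: "torus_act S (torus_of x) = torus_of (real_mat S *v x)"
  by (simp add: torus_act.abs_eq)

lemma torus_of_add: "torus_of x + torus_of y = torus_of (x + y)"
  by (simp add: plus_torus.abs_eq)

lemma torus_of_minus: "- torus_of x = torus_of (- x)"
  by (simp add: uminus_torus.abs_eq)

lemma torus_of_diff: "torus_of x - torus_of y = torus_of (x - y)"
  by (simp add: minus_torus_def torus_of_minus torus_of_add)

lemma torus_of_cases: obtains y where "x = torus_of y"
  by (metis Quotient3_abs_rep Quotient3_torus)

lemma torus_of_periodic: "torus_of (x + (2 * pi) *\<^sub>R real_vec k) = torus_of x"
  by (auto simp: torus.abs_eq_iff torus_rel_def)

lemma torus_act_add: "torus_act S (x + y) = torus_act S x + torus_act S y"
  by (cases x rule: torus_of_cases; cases y rule: torus_of_cases)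
    (simp add: torus_of_add torus_act_torus_of matrix_vector_right_distrib)

lemma torus_act_cancel:
  assumes "S \<in> Oh"
  shows "torus_act S (torus_act (transpose S) x) = x"
  by (cases x rule: torus_of_cases)
    (simp add: torus_act_torus_of assms Oh_real_mat_cancel)

lemma character_torus_of: "character k (torus_of x) = cis (real_vec k \<bullet> x)"
  by (simp add: character.abs_eq)

lemma character_add: "character k (x + y) = character k x * character k y"
  by (cases x rule: torus_of_cases; cases y rule: torus_of_cases)
    (simp add: torus_of_add character_torus_of inner_add_right cis_mult)

lemma character_minus_arg: "character k (- x) = character (- k) x"
  by (cases x rule: torus_of_cases)
    (simp add: torus_of_minus character_torus_of real_vec_minus)

lemma character_torus_act: "character k (torus_act S x) = character (transpose S *v k) x"
proof (cases x rule: torus_of_cases)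
  case (1 y)
  have "real_vec k \<bullet> (real_mat S *v y) = real_vec (transpose S *v k) \<bullet> y"
    by (metis dot_lmul_matrix real_mat_transpose real_mat_vec transpose_matrix_vector)
  then show ?thesis
    by (simp add: 1 torus_act_torus_of character_torus_of)
qed

section \<open>Equivariance of the advection term\<close>

text \<open>By linearity the coordinate sum is the derivative of \<open>w\<close> in the direction
  \<open>v x\<close>, a form to which the chain rule applies. The condition in
  \<open>partial\<close> does not depend on the direction, so in the degenerate case all summands
  are 0.\<close>

lemma advect_eq_frechet_derivative:
  "advect v w x =
     (if (\<lambda>y. w (x + torus_of y)) differentiable (at 0)
      then frechet_derivative (\<lambda>y. w (x + torus_of y)) (at 0) (v x) else 0)"
proof (cases "(\<lambda>y. w (x + torus_of y)) differentiable (at 0)")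
  case True
  define D where "D = frechet_derivative (\<lambda>y. w (x + torus_of y)) (at 0)"
  have "linear D"
    unfolding D_def by (rule linear_frechet_derivative[OF True])
  then have "D (v x) = D (\<Sum>s\<in>UNIV. v x $ s *\<^sub>R axis s 1)"
    using basis_expansion[of "v x"] by (simp add: scalar_mult_eq_scaleR)
  also have "\<dots> = (\<Sum>s\<in>UNIV. v x $ s *\<^sub>R D (axis s 1))"
    using \<open>linear D\<close> by (simp add: linear_sum linear_scale)
  finally show ?thesis
    using True by (simp add: advect_def partial_def D_def)
qed (simp add: advect_def partial_def)

lemma push_apply: "push (S, a) v x = real_mat S *v v (torus_act (transpose S) (x - a))"
  by (simp add: push_def)

text \<open>In the charts at \<open>x\<close> and at its preimage \<open>z\<close>, the pushed field
  is \<open>M\<close> after \<open>W\<close> after \<open>N\<close>. The chain rule turns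
  \<open>D\<close> into \<open>M D N\<close>, and in the direction \<open>M (v z)\<close> the
  factors \<open>N\<close> and \<open>M\<close> cancel.\<close>

lemma advect_push:
  assumes "S \<in> Oh"
  shows "advect (push (S, a) v) (push (S, a) w) = push (S, a) (advect v w)"
proof
  fix x
  define z where "z = torus_act (transpose S) (x - a)"
  define W where "W = (\<lambda>y. w (z + torus_of y))"
  define W' where "W' = (\<lambda>y. push (S, a) w (x + torus_of y))"
  define M where "M = (*v) (real_mat S)"
  define N where "N = (*v) (real_mat (transpose S))"
  have MN: "N (M y) = y" "M (N y) = y" for y
    using assms by (simp_all add: M_def N_def Oh_real_mat_cancel)
  have lin: "bounded_linear M" "bounded_linear N"
    by (simp_all add: M_def N_def)
  then have [simp]: "M 0 = 0" "N 0 = 0"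
    by (simp_all add: linear_simps)
  \<comment> \<open>The translation \<open>a\<close> is absorbed in the base point \<open>z\<close>;
    only the linear part acts on the chart variable.\<close>
  have W': "W' y = M (W (N y))" for y
  proof -
    have "torus_act (transpose S) (x + torus_of y - a) = z + torus_of (N y)"
      unfolding z_def N_def torus_act_torus_of[symmetric] torus_act_add[symmetric]
      by (simp add: algebra_simps)
    then show ?thesis
      by (simp add: W'_def W_def push_apply M_def)
  qed
  have deriv: "(W' has_derivative (\<lambda>h. M (D (N h)))) (at 0)" if "(W has_derivative D) (at 0)" for D
  proof -
    have "(N has_derivative N) (at 0)"
      using lin by (simp add: bounded_linear_imp_has_derivative)
    then have "((\<lambda>y. W (N y)) has_derivative (\<lambda>h. D (N h))) (at 0)"
      by (rule has_derivative_compose) (simp add: that)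
    then show ?thesis
      unfolding W' by (rule bounded_linear.has_derivative[OF lin(1)])
  qed
  \<comment> \<open>The converse, from \<open>W = N W' M\<close>, ensures that the default value 0
    occurs on both sides together.\<close>
  have deriv': "W differentiable (at 0)" if diff: "W' differentiable (at 0)"
  proof -
    obtain D where "(W' has_derivative D) (at 0)"
      using diff by (auto simp: differentiable_def)
    then have "(W' has_derivative D) (at (M 0))" by simp
    moreover have "(M has_derivative M) (at 0)"
      using lin by (simp add: bounded_linear_imp_has_derivative)
    ultimately have "((\<lambda>y. W' (M y)) has_derivative (\<lambda>h. D (M h))) (at 0)"
      using has_derivative_compose by blast
    then have "((\<lambda>y. N (W' (M y))) has_derivative (\<lambda>h. N (D (M h)))) (at 0)"
      by (rule bounded_linear.has_derivative[OF lin(2)])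
    then show ?thesis
      by (auto simp: W' MN differentiable_def)
  qed
  show "advect (push (S, a) v) (push (S, a) w) x = push (S, a) (advect v w) x"
  proof (cases "W differentiable (at 0)")
    case True
    define D where "D = frechet_derivative W (at 0)"
    have "(W has_derivative D) (at 0)"
      using True by (simp add: D_def frechet_derivative_works)
    from deriv[OF this] have "W' differentiable (at 0)"
        "frechet_derivative W' (at 0) = (\<lambda>h. M (D (N h)))"
      by (auto simp: differentiable_def dest: frechet_derivative_at)
    moreover have "push (S, a) v x = M (v z)"
      by (simp add: push_apply M_def z_def)
    ultimately have "advect (push (S, a) v) (push (S, a) w) x = M (D (v z))"
      by (simp add: advect_eq_frechet_derivative MN flip: W'_def)
    also have "D (v z) = advect v w z"
      using True by (simp add: advect_eq_frechet_derivative D_def flip: W_def)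
    finally show ?thesis
      by (simp add: push_apply[of S a "advect v w"] M_def z_def)
  next
    case False
    then have "advect (push (S, a) v) (push (S, a) w) x = 0" "advect v w z = 0"
      using deriv' by (auto simp: advect_eq_frechet_derivative simp flip: W'_def W_def)
    then show ?thesis
      by (simp add: push_apply[of S a "advect v w"] flip: z_def)
  qed
qed

section \<open>Invariance of the integral over the torus\<close>

text \<open>Moving a period box along one axis by at most one period only carries a slab to the
  opposite face, where the periodic integrand takes the same values. The bounds on \<open>t\<close>
  keep the cut inside the box.\<close>

lemma torus_box_translate_one:
  fixes f :: "torus \<Rightarrow> complex"
  assumes f: "((\<lambda>y. f (torus_of y)) has_integral I) (cbox c (c + (\<chi> s. 2 * pi)))"
    and t: "0 \<le> t" "t \<le> 2 * pi"
  shows "((\<lambda>y. f (torus_of y)) has_integral I) (cbox (c + axis s t) (c + axis s t + (\<chi> s. 2 * pi)))"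
proof -
  define F where "F = (\<lambda>y. f (torus_of y))"
  define T :: "real ^ 3" where "T = (\<chi> s. 2 * pi)"
  define d where "d = c + axis s t"
  define e :: "real ^ 3" where "e = axis s (2 * pi)"
  have per: "F (y - e) = F y" for y
  proof -
    have "e = (2 * pi) *\<^sub>R real_vec (axis s 1)"
      by (simp add: e_def real_vec_def axis_def vec_eq_iff)
    then show ?thesis
      using torus_of_periodic[of "y - e" "axis s 1"] by (simp add: F_def)
  qed
  have basis: "axis s (1 :: real) \<in> Basis"
    by (simp add: axis_in_Basis_iff)
  have nth: "x \<bullet> axis s 1 = x $ s" for x :: "real ^ 3"
    by (simp add: inner_axis)
  \<comment> \<open>By periodicity the slab \<open>L\<close> moves to the opposite face of the box.\<close>
  define K where "K = c $ s + t"
  define L where "L = cbox c (c + T) \<inter> {x. x $ s \<le> K}"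
  define R where "R = cbox c (c + T) \<inter> {x. x $ s \<ge> K}"
  have F: "F integrable_on cbox c (c + T)"
    using f by (auto simp: F_def T_def)
  obtain J1 J2 where J: "(F has_integral J1) L" "(F has_integral J2) R"
    using integrable_split[OF F basis, of K] by (auto simp: nth L_def R_def integrable_on_def)
  have "(F has_integral (J1 + J2)) (cbox c (c + T))"
    using has_integral_split[of F J1 c "c + T" "axis s 1" K J2] J basis
    by (simp add: nth L_def R_def)
  then have I: "I = J2 + J1"
    using has_integral_unique[OF f] by (simp add: F_def T_def)
  have split: "cbox a b \<inter> {x. x $ s \<le> m} = cbox a (\<chi> i. if i = s then min (b $ s) m else b $ i)"
      "cbox a b \<inter> {x. x $ s \<ge> m} = cbox (\<chi> i. if i = s then max (a $ s) m else a $ i) b"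
    for a b :: "real ^ 3" and m
    using interval_split_cart[where a = a and b = b and k = s and c = m] by (simp_all add: interval_cbox_cart)
  have "L = cbox c (\<chi> i. if i = s then K else c $ i + 2 * pi)"
    unfolding L_def split using t
    by (intro arg_cong2[where f = cbox]) (auto simp: K_def T_def vec_eq_iff)
  then have "((\<lambda>x. F (x + (- e))) has_integral J1)
      (cbox (c - (- e)) ((\<chi> i. if i = s then K else c $ i + 2 * pi) - (- e)))"
    using J(1) by (intro has_integral_shift_cbox) simp
  also have "(\<lambda>x. F (x + (- e))) = F"
    using per by simp
  also have "cbox (c - (- e)) ((\<chi> i. if i = s then K else c $ i + 2 * pi) - (- e))
      = cbox d (d + T) \<inter> {x. x $ s \<ge> c $ s + 2 * pi}"
    unfolding split using t
    by (intro arg_cong2[where f = cbox]) (auto simp: K_def T_def d_def e_def axis_def vec_eq_iff)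
  finally have right: "(F has_integral J1) (cbox d (d + T) \<inter> {x. x \<bullet> axis s 1 \<ge> c $ s + 2 * pi})"
    by (simp add: nth)
  \<comment> \<open>The new box is cut at the old upper face \<open>c $ s + 2 * pi\<close>: the
    moved slab lies above it, while \<open>R\<close> stays in place below it.\<close>
  have "R = cbox d (d + T) \<inter> {x. x $ s \<le> c $ s + 2 * pi}"
    unfolding R_def split using t
    by (intro arg_cong2[where f = cbox]) (auto simp: K_def T_def d_def axis_def vec_eq_iff)
  then have left: "(F has_integral J2) (cbox d (d + T) \<inter> {x. x \<bullet> axis s 1 \<le> c $ s + 2 * pi})"
    using J(2) by (simp add: nth)
  show ?thesis
    using has_integral_split[OF left right basis] by (simp add: I F_def d_def T_def)
qed

text \<open>The corner is moved from \<open>c\<close> to \<open>d\<close> one coordinate at a time,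
  each displacement being a number of whole periods plus a remainder within one period.\<close>

lemma torus_box_translate:
  fixes f :: "torus \<Rightarrow> complex"
  assumes f: "((\<lambda>y. f (torus_of y)) has_integral I) (cbox c (c + (\<chi> s. 2 * pi)))"
  shows "((\<lambda>y. f (torus_of y)) has_integral I) (cbox d (d + (\<chi> s. 2 * pi)))"
proof -
  define P where "P = (\<lambda>c. ((\<lambda>y. f (torus_of y)) has_integral I) (cbox c (c + (\<chi> s. 2 * pi))))"
  have small: "P (c + axis s t)" if "P c" "0 \<le> t" "t \<le> 2 * pi" for c s t
    using torus_box_translate_one that unfolding P_def by blast
  have period: "P (c + (2 * pi) *\<^sub>R real_vec k)" if "P c" for c k
  proof -
    have "torus_of (y - (2 * pi) *\<^sub>R real_vec k) = torus_of y" for y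
      using torus_of_periodic[of "y - (2 * pi) *\<^sub>R real_vec k" k] by simp
    then show ?thesis
      using has_integral_shift_cbox[OF that[unfolded P_def], of "- (2 * pi) *\<^sub>R real_vec k"]
      by (simp add: P_def algebra_simps)
  qed
  have any: "P (c + axis s t)" if "P c" for c s t
  proof -
    define n where "n = \<lfloor>t / (2 * pi)\<rfloor>"
    have "0 \<le> t - 2 * pi * n" "t - 2 * pi * n \<le> 2 * pi"
      unfolding n_def using floor_divide_lower[of "2 * pi" t] floor_divide_upper[of "2 * pi" t]
      by (auto simp: algebra_simps)
    then have "P (c + axis s (t - 2 * pi * n) + (2 * pi) *\<^sub>R real_vec (axis s n))"
      by (intro period small that)
    also have "c + axis s (t - 2 * pi * n) + (2 * pi) *\<^sub>R real_vec (axis s n) = c + axis s t"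
      by (simp add: real_vec_def axis_def vec_eq_iff)
    finally show ?thesis .
  qed
  \<comment> \<open>Induction over the set of axes already treated; \<open>A = UNIV\<close> gives
    the full displacement \<open>d - c\<close>.\<close>
  have "P (c + (\<Sum>s\<in>A. axis s (x $ s)))" for A and x :: "real ^ 3"
  proof (induction A rule: infinite_finite_induct)
    case (insert s A)
    from any[OF insert.IH, of s "x $ s"] insert.hyps show ?case
      by (simp add: algebra_simps)
  qed (use f in \<open>simp_all add: P_def\<close>)
  from this[of "d - c" UNIV] have "P (c + (\<Sum>s\<in>UNIV. axis s ((d - c) $ s)))" .
  also have "(\<Sum>s\<in>UNIV. axis s ((d - c) $ s)) = d - c"
    by (simp add: vec_eq_iff axis_def)
  finally show ?thesis
    by (simp add: P_def)
qed

text \<open>A signed permutation permutes the sides of a box and reflects some of them, so lengths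
  and volume survive. This supplies the hypotheses of the change of variables
  \<open>has_integral_twiddle\<close>.\<close>

lemma Oh_image_cbox:
  assumes "S \<in> Oh"
  obtains w z where "(\<lambda>y. real_mat S *v y) ` cbox u v = cbox w z"
    and "measure lborel (cbox w z) = measure lborel (cbox u v)"
proof -
  obtain \<sigma> \<epsilon> where \<sigma>: "bij \<sigma>" "\<And>s. \<epsilon> s = 1 \<or> \<epsilon> s = (-1 :: real)"
      "\<And>x s. (real_mat S *v x) $ s = \<epsilon> s * x $ \<sigma> s"
    by (rule Oh_coordinates[OF assms]) (rule that; assumption)
  \<comment> \<open>A sign -1 reflects the side and so exchanges its endpoints.\<close>
  define w z where "w = (\<chi> s. if \<epsilon> s = 1 then u $ \<sigma> s else - v $ \<sigma> s)"
    and "z = (\<chi> s. if \<epsilon> s = 1 then v $ \<sigma> s else - u $ \<sigma> s)"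
  have mem: "real_mat S *v y \<in> cbox w z \<longleftrightarrow> y \<in> cbox u v" for y
  proof -
    have "w $ s \<le> \<epsilon> s * y $ \<sigma> s \<and> \<epsilon> s * y $ \<sigma> s \<le> z $ s
        \<longleftrightarrow> u $ \<sigma> s \<le> y $ \<sigma> s \<and> y $ \<sigma> s \<le> v $ \<sigma> s" for s
      using \<sigma>(2)[of s] by (auto simp: w_def z_def)
    then have "real_mat S *v y \<in> cbox w z \<longleftrightarrow> (\<forall>s. u $ \<sigma> s \<le> y $ \<sigma> s \<and> y $ \<sigma> s \<le> v $ \<sigma> s)"
      by (simp add: mem_box_cart \<sigma>(3))
    also have "\<dots> \<longleftrightarrow> y \<in> cbox u v"
      unfolding mem_box_cart using \<sigma>(1) by (metis bij_pointE)
    finally show ?thesis .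
  qed
  have image: "(\<lambda>y. real_mat S *v y) ` cbox u v = cbox w z"
  proof
    show "cbox w z \<subseteq> (\<lambda>y. real_mat S *v y) ` cbox u v"
    proof
      fix x assume "x \<in> cbox w z"
      then show "x \<in> (\<lambda>y. real_mat S *v y) ` cbox u v"
        using mem[of "real_mat (transpose S) *v x"] Oh_real_mat_cancel(2)[OF assms, of x]
        by (metis image_eqI)
    qed
  qed (use mem in auto)
  have len: "z $ s - w $ s = v $ \<sigma> s - u $ \<sigma> s" for s
    by (simp add: w_def z_def)
  have "measure lborel (cbox w z) = measure lborel (cbox u v)"
  \<comment> \<open>The product formula for the volume holds for nonempty boxes only.\<close>
  proof (cases "cbox u v = {}")
    case False
    then have "cbox w z \<noteq> {}"
      using image by blast
    moreover have "(\<Prod>s\<in>UNIV. v $ \<sigma> s - u $ \<sigma> s) = (\<Prod>s\<in>UNIV. v $ s - u $ s)"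
      using prod.reindex_bij_betw[OF \<sigma>(1), of "\<lambda>s. v $ s - u $ s"] .
    ultimately show ?thesis
      using False by (simp add: content_cbox_cart len)
  qed (use image in simp)
  with image show thesis
    by (rule that)
qed

text \<open>\<open>torus_box\<close> itself need not be invariant under \<open>S\<close>. The
  integral is therefore moved to a centred box, transformed by \<open>S\<close> there, shifted by
  \<open>a0\<close> and moved back to \<open>torus_box\<close>.\<close>

lemma torus_box_has_integral_isometry:
  fixes f :: "torus \<Rightarrow> complex"
  assumes S: "S \<in> Oh" and f: "((\<lambda>y. f (torus_of y)) has_integral I) torus_box"
  shows "((\<lambda>y. f (torus_act S (torus_of y - a))) has_integral I) torus_box"
proof -
  obtain a0 where a0: "a = torus_of a0"
    by (rule torus_of_cases)
  \<comment> \<open>The box centred at the origin is mapped onto itself by \<open>S\<close>.\<close>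
  define p :: "real ^ 3" where "p = (\<chi> s. pi)"
  have p: "(\<chi> s. 2 * pi) = 2 *\<^sub>R p"
    by (simp add: p_def vec_eq_iff)
  define M where "M = (\<lambda>y. real_mat S *v y)"
  define N where "N = (\<lambda>y. real_mat (transpose S) *v y)"
  have MN: "N (M y) = y" "M (N y) = y" for y
    using S by (simp_all add: M_def N_def Oh_real_mat_cancel)
  have M: "\<exists>w z. M ` cbox u v = cbox w z" "measure lborel (M ` cbox u v) = 1 * measure lborel (cbox u v)"
    and N: "\<exists>w z. N ` cbox u v = cbox w z" for u v
  proof -
    obtain w z where "M ` cbox u v = cbox w z" "measure lborel (cbox w z) = measure lborel (cbox u v)"
      unfolding M_def by (rule Oh_image_cbox[OF S])
    then show "\<exists>w z. M ` cbox u v = cbox w z" "measure lborel (M ` cbox u v) = 1 * measure lborel (cbox u v)"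
      by auto
    show "\<exists>w z. N ` cbox u v = cbox w z"
      unfolding N_def by (rule Oh_image_cbox[OF Oh_transpose[OF S], of u v]) blast
  qed
  obtain \<sigma> \<epsilon> where \<sigma>: "bij \<sigma>" "\<And>s. \<epsilon> s = 1 \<or> \<epsilon> s = (-1 :: real)"
      "\<And>x s. (real_mat S *v x) $ s = \<epsilon> s * x $ \<sigma> s"
    by (rule Oh_coordinates[OF S]) (rule that; assumption)
  have "M y \<in> cbox (-p) p \<longleftrightarrow> y \<in> cbox (-p) p" for y
  proof -
    have "- pi \<le> \<epsilon> s * y $ \<sigma> s \<and> \<epsilon> s * y $ \<sigma> s \<le> pi \<longleftrightarrow> - pi \<le> y $ \<sigma> s \<and> y $ \<sigma> s \<le> pi" for s
      using \<sigma>(2)[of s] by auto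
    then show ?thesis
      unfolding mem_box_cart by (simp add: M_def \<sigma>(3) p_def) (metis \<sigma>(1) bij_pointE)
  qed
  then have box: "N ` cbox (-p) p = cbox (-p) p"
    using MN by (metis (no_types, lifting) image_eqI image_subset_iff subsetI subset_antisym)
  have "((\<lambda>y. f (torus_of y)) has_integral I) (cbox (-p) p)"
    using torus_box_translate[of f I 0 "-p"] f by (simp add: torus_box_def p scaleR_2)
  \<comment> \<open>The factor \<open>1 / 1\<close> is the inverse of the volume ratio
    \<open>r = 1\<close>.\<close>
  then have "((\<lambda>y. f (torus_of (M y))) has_integral (1 / 1) *\<^sub>R I) (N ` cbox (-p) p)"
    by (intro has_integral_twiddle[where g = M and h = N and r = 1])
      (simp_all add: MN M N, simp add: M_def linear_continuous_at)
  then have "((\<lambda>y. f (torus_of (M (y + (- a0))))) has_integral I) (cbox (-p - (- a0)) (p - (- a0)))"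
    unfolding box by (intro has_integral_shift_cbox) simp
  then show ?thesis
    using torus_box_translate[of "\<lambda>x. f (torus_act S (x - a))" I "a0 - p" 0]
    by (simp add: a0 torus_of_diff torus_act_torus_of M_def torus_box_def p scaleR_2 add.commute)
qed

text \<open>Using the previous lemma for the map and for its inverse makes the two integrands have
  exactly the same integrals. Equality thus includes the default value for non-integrable
  functions.\<close>

lemma torus_box_integral_isometry:
  fixes f :: "torus \<Rightarrow> complex"
  assumes S: "S \<in> Oh"
  shows "integral torus_box (\<lambda>y. f (torus_act S (torus_of y - a))) = integral torus_box (\<lambda>y. f (torus_of y))"
proof -
  define g where "g = (\<lambda>x. f (torus_act S (x - a)))"
  \<comment> \<open>The inverse of \<open>x\<close> going to \<open>S (x - a)\<close> has the same
    shape, with matrix \<open>transpose S\<close> and translation \<open>S (- a)\<close>.\<close>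
  have f: "f x = g (torus_act (transpose S) (x - torus_act S (- a)))" for x
    using torus_act_cancel[OF S, of "x - torus_act S (- a)"]
      torus_act_add[of S "torus_act (transpose S) (x - torus_act S (- a))" "- a"]
    by (simp add: g_def)
  have "((\<lambda>y. f (torus_of y)) has_integral I) torus_box"
    if "((\<lambda>y. g (torus_of y)) has_integral I) torus_box" for I
    using torus_box_has_integral_isometry[OF Oh_transpose[OF S] that, of "torus_act S (- a)"]
    by (simp flip: f)
  moreover have "((\<lambda>y. g (torus_of y)) has_integral I) torus_box"
    if "((\<lambda>y. f (torus_of y)) has_integral I) torus_box" for I
    using torus_box_has_integral_isometry[OF S that] by (simp add: g_def)
  ultimately have "((\<lambda>y. g (torus_of y)) has_integral I) torus_box \<longleftrightarrow>
      ((\<lambda>y. f (torus_of y)) has_integral I) torus_box" for I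
    by blast
  then show ?thesis
    by (simp add: integral_def integrable_on_def g_def)
qed

section \<open>Equivariance of the Leray projection and of the bilinear map\<close>

text \<open>In the Fourier integral the substitution by the isometry moves the frequency to
  \<open>transpose S *v k\<close>; the translation contributes the phase
  \<open>character (- k) a\<close>, and \<open>S\<close> acts on the components.\<close>

lemma fourier_coeff_push:
  assumes S: "S \<in> Oh"
  shows "fourier_coeff (push (S, a) v) k =
    character (- k) a *s (complex_mat S *v fourier_coeff v (transpose S *v k))"
proof -
  obtain \<sigma> \<epsilon> where \<sigma>: "\<And>x s. (real_mat S *v x) $ s = \<epsilon> s * x $ \<sigma> s"
    "\<And>x s. (complex_mat S *v x) $ s = complex_of_real (\<epsilon> s) * x $ \<sigma> s"
    by (rule Oh_coordinates[OF S]) (rule that; assumption)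
  define l where "l = transpose S *v k"
  define F where "F = (\<lambda>s x. complex_of_real (v x $ \<sigma> s) * character (- l) x)"
  have "complex_of_real (push (S, a) v x $ s) * character (- k) x =
      (complex_of_real (\<epsilon> s) * character (- k) a) * F s (torus_act (transpose S) (x - a))" for x s
  proof -
    have "S *v (- l) = - k"
      using Oh_int_cancel(2)[OF S, of "- k"] by (simp add: l_def matrix_vector_mult_minus_right)
    then have "character (- l) (torus_act (transpose S) (x - a)) = character (- k) (x - a)"
      by (simp add: character_torus_act)
    moreover have "character (- k) x = character (- k) a * character (- k) (x - a)"
      by (simp flip: character_add)
    ultimately show ?thesis
      by (simp add: push_apply \<sigma> F_def)
  qed
  moreover have "integral torus_box (\<lambda>y. F s (torus_act (transpose S) (torus_of y - a))) =
      integral torus_box (\<lambda>y. F s (torus_of y))" for s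
    by (rule torus_box_integral_isometry[OF Oh_transpose[OF S]])
  ultimately show ?thesis
    by (simp add: vec_eq_iff fourier_coeff_def \<sigma> F_def flip: l_def)
qed

lemma leray_symbol_scale: "leray_symbol k (c *s w) = c *s leray_symbol k w"
  by (simp add: leray_symbol_def cdot_def vec_eq_iff algebra_simps sum_distrib_left)

text \<open>The symbol at a nonzero \<open>k\<close> removes the component along \<open>k\<close>,
  using only the bilinear product and the norm. An orthogonal matrix preserves both and carries
  \<open>transpose S *v k\<close> to \<open>k\<close>.\<close>

lemma leray_symbol_Oh:
  assumes S: "S \<in> Oh"
  shows "leray_symbol k (complex_mat S *v w) = complex_mat S *v leray_symbol (transpose S *v k) w"
proof -
  define l where "l = transpose S *v k"
  have k: "k = S *v l"
    using S by (simp add: l_def Oh_int_cancel)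
  have vec: "complex_vec k = complex_mat S *v complex_vec l"
    by (simp add: k complex_vec_def complex_mat_def matrix_vector_mult_def vec_eq_iff)
  obtain \<sigma> \<epsilon> where \<sigma>: "bij \<sigma>" "\<And>s. \<epsilon> s = 1 \<or> \<epsilon> s = (-1 :: real)"
      "\<And>x s. (real_mat S *v x) $ s = \<epsilon> s * x $ \<sigma> s"
      "\<And>x s. (complex_mat S *v x) $ s = complex_of_real (\<epsilon> s) * x $ \<sigma> s"
    by (rule Oh_coordinates[OF S]) (rule that; assumption)
  have "cdot (complex_mat S *v x) (complex_mat S *v y) = (\<Sum>s\<in>UNIV. x $ \<sigma> s * y $ \<sigma> s)" for x y
    unfolding cdot_def \<sigma>(4)
  proof (intro sum.cong refl)
    fix s
    show "complex_of_real (\<epsilon> s) * x $ \<sigma> s * (complex_of_real (\<epsilon> s) * y $ \<sigma> s) = x $ \<sigma> s * y $ \<sigma> s"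
      using \<sigma>(2)[of s] by auto
  qed
  then have cdot: "cdot (complex_mat S *v x) (complex_mat S *v y) = cdot x y" for x y
    using sum.reindex_bij_betw[OF \<sigma>(1), of "\<lambda>s. x $ s * y $ s"] by (simp add: cdot_def)
  have "orthogonal_matrix (real_mat S)"
    using S by (simp add: Oh_def orthogonal_matrix_def real_mat_1 flip: real_mat_transpose real_mat_mult)
  then have norm: "norm (real_vec k) = norm (real_vec l)"
    using orthogonal_transformation_norm[of "(*v) (real_mat S)" "real_vec l"]
    by (simp add: k orthogonal_transformation_matrix flip: real_mat_vec)
  have zero: "k = 0 \<longleftrightarrow> l = 0"
    using k by (auto simp: l_def)
  show ?thesis
    unfolding l_def[symmetric] leray_symbol_def
    by (simp add: zero norm vec cdot matrix_vector_mult_diff_distrib vector_scalar_commute)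
qed

lemma bounded_linear_complex_matrix: "bounded_linear ((*v) (A :: complex ^ 'n ^ 'm))"
  unfolding linear_conv_bounded_linear[symmetric]
  by (intro linearI)
    (simp_all add: matrix_vector_right_distrib,
      simp add: matrix_vector_mult_def vec_eq_iff scaleR_sum_right)

text \<open>The mode of the pushed field at \<open>k\<close> is \<open>S\<close> applied to the mode
  of \<open>v\<close> at \<open>transpose S *v k\<close>, evaluated at \<open>z\<close>. Since
  \<open>transpose S\<close> permutes the frequencies, summing over all of them gives the
  claim.\<close>

lemma leray_push:
  assumes S: "S \<in> Oh"
  shows "leray (push (S, a) v) = push (S, a) (leray v)"
proof
  fix x
  define z where "z = torus_act (transpose S) (x - a)"
  define G where "G = (\<lambda>k. character k z *s leray_symbol k (fourier_coeff v k))"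
  have G: "character k x *s leray_symbol k (fourier_coeff (push (S, a) v) k) =
      complex_mat S *v G (transpose S *v k)" for k
  proof -
    have "character (transpose S *v k) z = character k (x - a)"
      using S by (simp add: z_def character_torus_act Oh_int_cancel)
    also have "\<dots> = character k x * character (- k) a"
      using character_add[of k x "- a"] by (simp add: character_minus_arg)
    finally show ?thesis
      using S by (simp add: fourier_coeff_push leray_symbol_scale leray_symbol_Oh G_def
          vector_scalar_commute)
  qed
  \<comment> \<open>The left inverse makes both series summable or neither, and
    \<open>infsum\<close> is 0 in the latter case; convergence need not be known.\<close>
  have "(\<Sum>\<^sub>\<infinity>k. complex_mat S *v G (transpose S *v k)) = complex_mat S *v (\<Sum>\<^sub>\<infinity>k. G (transpose S *v k))"
    using S bounded_linear_complex_matrix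
    by (intro infsum_bounded_linear_strong
        summable_on_bounded_linear_iff[where h' = "(*v) (complex_mat (transpose S))"])
      (simp_all add: Oh_complex_mat_cancel)
  also have "(\<Sum>\<^sub>\<infinity>k. G (transpose S *v k)) = (\<Sum>\<^sub>\<infinity>k. G k)"
    using infsum_reindex_bij_betw[OF Oh_bij[OF Oh_transpose[OF S]], of G] .
  finally have sum: "(\<Sum>\<^sub>\<infinity>k. character k x *s leray_symbol k (fourier_coeff (push (S, a) v) k)) =
      complex_mat S *v (\<Sum>\<^sub>\<infinity>k. G k)"
    by (simp add: G)
  obtain \<sigma> \<epsilon> where \<sigma>: "\<And>x s. (real_mat S *v x) $ s = \<epsilon> s * x $ \<sigma> s"
    "\<And>x s. (complex_mat S *v x) $ s = complex_of_real (\<epsilon> s) * x $ \<sigma> s"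
    by (rule Oh_coordinates[OF S]) (rule that; assumption)
  show "leray (push (S, a) v) x = push (S, a) (leray v) x"
    unfolding leray_def sum push_apply z_def[symmetric]
    by (simp add: vec_eq_iff \<sigma> G_def)
qed

lemma bilin_push:
  assumes "S \<in> Oh"
  shows "bilin (push (S, a) v) (push (S, a) w) = push (S, a) (bilin v w)"
  using assms
  by (simp add: bilin_def fun_eq_iff advect_push leray_push)
    (simp add: push_apply bilin_def matrix_vector_mult_minus_right)

section \<open>Homogeneity and the recursion\<close>

text \<open>For nonzero \<open>c\<close>, scaling by \<open>1 / c\<close> shows that
  \<open>w\<close> and its multiple are differentiable at the same points. For \<open>c = 0\<close>
  the field is constant and both sides vanish.\<close>

lemma partial_scale: "partial s (\<lambda>x. c *\<^sub>R w x) x = c *\<^sub>R partial s w x"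
proof (cases "c = 0")
  case False
  define W where "W = (\<lambda>y. w (x + torus_of y))"
  have W_eq: "w (x + torus_of y) = W y" for y
    by (simp add: W_def)
  have deriv: "((\<lambda>y. c *\<^sub>R W y) has_derivative (\<lambda>h. c *\<^sub>R D h)) (at 0)" if "(W has_derivative D) (at 0)" for D
    using that by (rule has_derivative_scaleR_right)
  show ?thesis
  proof (cases "W differentiable (at 0)")
    case True
    then have D: "((\<lambda>y. c *\<^sub>R W y) has_derivative (\<lambda>h. c *\<^sub>R frechet_derivative W (at 0) h)) (at 0)"
      by (intro deriv) (simp add: frechet_derivative_works)
    show ?thesis
      using True differentiableI[OF D] frechet_derivative_at[OF D, symmetric]
      by (simp add: partial_def W_eq)
  next
    case W: False
    have "\<not> (\<lambda>y. c *\<^sub>R W y) differentiable (at 0)"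
    proof
      assume "(\<lambda>y. c *\<^sub>R W y) differentiable (at 0)"
      then obtain D where "((\<lambda>y. c *\<^sub>R W y) has_derivative D) (at 0)"
        by (auto simp: differentiable_def)
      from has_derivative_scaleR_right[OF this, of "1 / c"] show False
        using False W by (auto simp: differentiable_def)
    qed
    with W show ?thesis
      by (simp add: partial_def W_eq)
  qed
qed (simp add: partial_def frechet_derivative_const)

lemma advect_scale: "advect (\<lambda>x. c *\<^sub>R v x) (\<lambda>x. d *\<^sub>R w x) = (\<lambda>x. (c * d) *\<^sub>R advect v w x)"
  by (simp add: advect_def fun_eq_iff partial_scale scaleR_sum_right mult_ac)

lemma leray_scale: "leray (\<lambda>x. c *\<^sub>R v x) = (\<lambda>x. c *\<^sub>R leray v x)"
proof -
  have "fourier_coeff (\<lambda>x. c *\<^sub>R v x) k = complex_of_real c *s fourier_coeff v k" for k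
    by (simp add: fourier_coeff_def vec_eq_iff mult.assoc)
  then have "character k x *s leray_symbol k (fourier_coeff (\<lambda>x. c *\<^sub>R v x) k) =
      c *\<^sub>R (character k x *s leray_symbol k (fourier_coeff v k))" for k x
    by (simp add: leray_symbol_scale) (simp add: vec_eq_iff scaleR_conv_of_real[where 'a = complex])
  then show ?thesis
    by (simp add: leray_def fun_eq_iff infsum_scaleR_right) (simp add: vec_eq_iff)
qed

lemma bilin_scale: "bilin (\<lambda>x. c *\<^sub>R v x) (\<lambda>x. d *\<^sub>R w x) = (\<lambda>x. (c * d) *\<^sub>R bilin v w x)"
  by (simp add: fun_eq_iff bilin_def advect_scale leray_scale)

lemma push_sum_scale:
  "push g (\<lambda>x. c *\<^sub>R (\<Sum>l\<in>A. f l x)) = (\<lambda>x. c *\<^sub>R (\<Sum>l\<in>A. push g (f l) x))"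
  by (cases g) (simp add: push_apply fun_eq_iff matrix_vector_mult_scaleR linear_sum[OF matrix_vector_mul_linear])

text \<open>The recursion is that of the formal time series of a solution of
  \<open>u' = P(u, u)\<close>, whence the name. The sign \<open>e\<close> treats symmetries and
  pseudo-symmetries together.\<close>

lemma taylor_coefficients_push:
  fixes u :: "nat \<Rightarrow> vfield"
  assumes S: "S \<in> Oh" and e: "e = 1 \<or> e = (-1 :: real)"
    and sym: "push (S, a) (u 0) = (\<lambda>x. e *\<^sub>R u 0 x)"
    and u: "\<forall>j \<ge> 1. u j = (\<lambda>x. (1 / real j) *\<^sub>R (\<Sum>l<j. bilin (u l) (u (j - l - 1)) x))"
  shows "push (S, a) (u j) = (\<lambda>x. e ^ Suc j *\<^sub>R u j x)"
proof (induction j rule: less_induct)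
  case (less j)
  show ?case
  proof (cases "j = 0")
    case False
    have summand: "push (S, a) (bilin (u l) (u (j - l - 1))) = (\<lambda>x. e ^ Suc j *\<^sub>R bilin (u l) (u (j - l - 1)) x)"
      if "l < j" for l
    proof -
      have "push (S, a) (bilin (u l) (u (j - l - 1))) =
          bilin (\<lambda>x. e ^ Suc l *\<^sub>R u l x) (\<lambda>x. e ^ Suc (j - l - 1) *\<^sub>R u (j - l - 1) x)"
        using that by (simp add: less flip: bilin_push[OF S] del: power_Suc)
      \<comment> \<open>The exponents are \<open>l + 1\<close> and \<open>j - l\<close>, with sum
        \<open>j + 1\<close> for every \<open>l\<close>, so the sign comes out of the whole
        sum.\<close>
      moreover have "e ^ Suc l * e ^ Suc (j - l - 1) = e ^ Suc j"
        using that by (simp add: Suc_diff_Suc flip: power_add power_Suc)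
      ultimately show ?thesis
        by (simp only: bilin_scale)
    qed
    have uj: "u j = (\<lambda>x. (1 / real j) *\<^sub>R (\<Sum>l<j. bilin (u l) (u (j - l - 1)) x))"
      using u False by auto
    have "push (S, a) (u j) = (\<lambda>x. (1 / real j) *\<^sub>R (\<Sum>l<j. e ^ Suc j *\<^sub>R bilin (u l) (u (j - l - 1)) x))"
      unfolding uj push_sum_scale by (intro ext arg_cong2[where f = scaleR] sum.cong refl) (simp only: summand lessThan_iff)
    also have "\<dots> = (\<lambda>x. e ^ Suc j *\<^sub>R u j x)"
      unfolding uj by (simp add: mult.commute flip: scaleR_sum_right)
    finally show ?thesis .
  qed (simp add: sym)
qed

theorem mainTheorem4:
  fixes u :: "nat \<Rightarrow> vfield"
  assumes "u 0 \<in> analytic_fields"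
    and "\<forall>j \<ge> 1. u j = (\<lambda>x. (1 / real j) *\<^sub>R (\<Sum>l<j. bilin (u l) (u (j - l - 1)) x))"
  shows "\<forall>j. (\<forall>g \<in> symmetry_subgroup (u 0). push g (u j) = u j) \<and>
             (\<forall>g \<in> pseudo_symmetry_space (u 0).
                (\<lambda>x. - push g (u j) x) = (\<lambda>x. (-1) ^ j *\<^sub>R u j x))"
proof (intro allI conjI ballI)
  fix j g assume "g \<in> symmetry_subgroup (u 0)"
  then obtain S a where "g = (S, a)" "S \<in> Oh" "push (S, a) (u 0) = u 0"
    by (cases g) (auto simp: symmetry_subgroup_def Oh_torus_def)
  then show "push g (u j) = u j"
    using taylor_coefficients_push[of S 1 a u j] assms(2) by simp
next
  fix j g assume "g \<in> pseudo_symmetry_space (u 0)"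
  then obtain S a where g: "g = (S, a)" "S \<in> Oh" and "(\<lambda>x. - push (S, a) (u 0) x) = u 0"
    by (cases g) (auto simp: pseudo_symmetry_space_def Oh_torus_def)
  then have "push (S, a) (u 0) = (\<lambda>x. (-1) *\<^sub>R u 0 x)"
    by (metis (no_types, lifting) minus_minus scaleR_minus1_left)
  \<comment> \<open>With \<open>e = -1\<close> the push gives the sign
    \<open>(-1) ^ (j + 1)\<close>; the outer minus reduces it to \<open>(-1) ^ j\<close>.\<close>
  then show "(\<lambda>x. - push g (u j) x) = (\<lambda>x. (-1) ^ j *\<^sub>R u j x)"
    using taylor_coefficients_push[of S "-1" a u j] assms(2) g by simp
qed

end
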